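(* Let $p$ be an odd prime number. Then $p^2$ is not a very perfect number; that is, $\sigma(\sigma(p^2)) \neq 2p^2$.
   Context: For a natural number $x \geq 1$, $\sigma(x)$ denotes the sum of all positive divisors of $x$ (including $1$ and $x$). A natural number $n \geq 1$ is called very perfect if $\sigma(\sigma(n)) = 2n$. *)

theory Defs
  imports "HOL-Computational_Algebra.Primes"
begin

(* Only used for x >= 1, where every natural number dividing x is positive.
   For x = 0 the divisor set is infinite and the sum is 0 by convention. *)
definition sigma :: "nat \<Rightarrow> nat" where
  "sigma x = (\<Sum>d | d dvd x. d)"

definition very_perfect :: "nat \<Rightarrow> bool" where
  "very_perfect n \<longleftrightarrow> n \<ge> 1 \<and> sigma (sigma n) = 2 * n"

end

theory Submission
  imports Defs
begin

text \<open>
  Write \<open>m = \<sigma>(p\<^sup>2) = 1 + p + p\<^sup>2\<close>, an odd number, and suppose \<open>\<sigma>(m) = 2p\<^sup>2\<close>.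

  If \<open>m\<close> is a power of a prime \<open>q\<close>, then \<open>q\<close> is odd, and comparison with a geometric series
  gives \<open>\<sigma>(m) \<le> 3m/2\<close> (\<open>sigma_odd_prime_power_le\<close>). This contradicts \<open>\<sigma>(m) = 2p\<^sup>2\<close> as soon
  as \<open>p > 3\<close>; for \<open>p = 3\<close> one has \<open>m = 13\<close> and \<open>\<sigma>(13) = 14 \<noteq> 18\<close>.

  Otherwise \<open>m = uv\<close> with coprime odd \<open>u, v > 1\<close>, and \<open>\<sigma>(u) \<sigma>(v) = 2p\<^sup>2\<close>. Both factors exceed
  \<open>2\<close>, so one of them equals \<open>p\<close> and the other \<open>2p\<close>. A number \<open>u\<close> whose divisor sum is prime is
  a power of a prime \<open>r\<close>, by multiplicativity, hence \<open>p = \<sigma>(u) \<equiv> 1 (mod r)\<close>. Since also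
  \<open>r\<close> divides \<open>m = 1 + p + p\<^sup>2 \<equiv> 3 (mod r)\<close>, the prime \<open>r\<close> is \<open>3\<close>. But \<open>u = 3\<close> would give
  \<open>p = 4\<close>, and \<open>9\<close> dividing \<open>u\<close> is impossible, because \<open>1 + p + p\<^sup>2 \<equiv> 3 (mod 9)\<close> whenever
  \<open>p \<equiv> 1 (mod 3)\<close>.
\<close>

lemma sigma_mult_coprime:
  assumes "coprime a b"
  shows "sigma (a * b) = sigma a * sigma b"
proof -
  let ?D = "\<lambda>n::nat. {d. d dvd n}"
  have inj: "inj_on (\<lambda>(x, y). x * y) (?D a \<times> ?D b)"
  proof (rule inj_onI, clarify)
    fix x y x' y' assume dvds: "x dvd a" "y dvd b" "x' dvd a" "y' dvd b"
      and eq: "x * y = x' * y'"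
    have "coprime x y'" "coprime x' y" "coprime y x'" "coprime y' x"
      using dvds assms by (blast intro: coprime_divisors coprime_commute[THEN iffD1])+
    moreover have "x dvd x' * y'" "x' dvd x * y" "y dvd x' * y'" "y' dvd x * y"
      by (simp_all flip: eq) (simp_all add: eq)
    ultimately have "x dvd x'" "x' dvd x" "y dvd y'" "y' dvd y"
      by (simp_all add: coprime_dvd_mult_left_iff coprime_dvd_mult_right_iff)
    then show "x = x' \<and> y = y'" by (simp add: dvd_antisym)
  qed
  have img: "(\<lambda>(x, y). x * y) ` (?D a \<times> ?D b) = ?D (a * b)"
    by (force intro: mult_dvd_mono elim: dvd_productE)
  have "sigma (a * b) = (\<Sum>(x, y)\<in>?D a \<times> ?D b. x * y)"
    unfolding sigma_def img[symmetric] by (subst sum.reindex[OF inj]) (simp add: case_prod_beta)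
  also have "\<dots> = sigma a * sigma b"
    by (simp add: sigma_def sum_product sum.cartesian_product)
  finally show ?thesis .
qed

lemma sigma_prime_power:
  assumes "prime (q::nat)"
  shows "sigma (q ^ k) = (\<Sum>i\<le>k. q ^ i)"
proof -
  have "{d. d dvd q ^ k} = (\<lambda>i. q ^ i) ` {..k}"
    using divides_primepow_nat[OF assms] by (auto intro: le_imp_power_dvd)
  moreover have "inj_on (\<lambda>i. q ^ i) {..k}"
    using prime_gt_1_nat[OF assms] by (auto intro: inj_onI)
  ultimately show ?thesis by (simp add: sigma_def sum.reindex)
qed

lemma sigma_gt:
  assumes "n > 1"
  shows "sigma n > n"
proof -
  have "(\<Sum>d\<in>{1, n}. d) \<le> sigma n"
    unfolding sigma_def using assms by (intro sum_mono2) auto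
  then show ?thesis using assms by simp
qed

text \<open>The constant is \<open>q / (q - 1)\<close>, the sum of the full geometric series, at \<open>q = 3\<close>.\<close>

lemma sigma_odd_prime_power_le:
  assumes "prime (q::nat)" "q \<ge> 3"
  shows "2 * sigma (q ^ k) \<le> 3 * q ^ k"
proof -
  have "2 * (\<Sum>i\<le>k. q ^ i) \<le> 3 * q ^ k"
  proof (induction k)
    case (Suc k)
    have "3 * q ^ k \<le> q ^ Suc k" using assms(2) by simp
    moreover have "(\<Sum>i\<le>Suc k. q ^ i) = (\<Sum>i\<le>k. q ^ i) + q ^ Suc k" by simp
    ultimately show ?case using Suc by linarith
  qed simp
  then show ?thesis by (simp add: sigma_prime_power assms(1))
qed

lemma sigma_prime_power_mod:
  assumes "prime (r::nat)"
  shows "\<exists>c. sigma (r ^ b) = 1 + r * c"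
proof (induction b)
  case 0
  show ?case by (rule exI[of _ 0]) (simp add: sigma_def)
next
  case (Suc b)
  then obtain c where c: "sigma (r ^ b) = 1 + r * c" ..
  have "sigma (r ^ Suc b) = sigma (r ^ b) + r * r ^ b"
    unfolding sigma_prime_power[OF assms] by simp
  then have "sigma (r ^ Suc b) = 1 + r * (c + r ^ b)" using c by (simp add: distrib_left)
  then show ?case ..
qed

lemma prime_power_cofactor:
  assumes "n > (1::nat)"
  obtains q k v where "prime q" "k > 0" "n = q ^ k * v" "coprime (q ^ k) v" "v > 0"
proof -
  obtain q where q: "prime q" "q dvd n"
    using prime_factor_nat[of n] assms by auto
  obtain v where v: "n = q ^ multiplicity q n * v" "\<not> q dvd v"
    using multiplicity_decompose'[of n q] assms q by (metis not_one_less_zero not_prime_unit)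
  have "coprime (q ^ multiplicity q n) v"
    using v(2) q(1) by (simp add: coprime_power_left_iff prime_imp_coprime)
  moreover have "multiplicity q n > 0"
    using q assms by (simp add: prime_multiplicity_gt_zero_iff)
  moreover have "v > 0" using v assms by (cases v) auto
  ultimately show ?thesis using that q v by blast
qed

text \<open>
  Splitting off a full prime power from \<open>u\<close> splits \<open>\<sigma>(u)\<close> into two factors, one of which must
  be \<open>1\<close>; only \<open>1\<close> itself has divisor sum \<open>1\<close>.
\<close>

lemma prime_sigma_imp_prime_power:
  assumes "prime (sigma u)" "u > 1"
  obtains r b where "prime r" "b > 0" "u = r ^ b"
proof -
  obtain r b v where rb: "prime r" "b > 0" "u = r ^ b * v" "coprime (r ^ b) v" "v > 0"
    using prime_power_cofactor[OF assms(2)] .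
  have "r ^ b > 1" using one_less_power[OF prime_gt_1_nat] rb(1,2) by blast
  then have "sigma (r ^ b) > 1" using sigma_gt by fastforce
  moreover have "sigma u = sigma (r ^ b) * sigma v"
    using rb by (simp add: sigma_mult_coprime)
  ultimately have "sigma v = 1"
    using assms(1) by (metis less_irrefl nat_mult_1_right prime_product)
  then have "v = 1" using sigma_gt[of v] rb(5) by (cases "v = 1") auto
  with that rb show ?thesis by simp
qed

text \<open>The divisors of \<open>2p\<^sup>2\<close> pair up as \<open>{1, 2p\<^sup>2}\<close>, \<open>{2, p\<^sup>2}\<close> and \<open>{p, 2p}\<close>.\<close>

lemma factor_twice_prime_square:
  fixes p x y :: nat
  assumes "prime p" "x * y = 2 * p ^ 2" "x > 2" "y > 2"
  shows "x = p \<or> y = p"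
proof -
  \<comment> \<open>If \<open>p\<close> is coprime to one factor, the whole of \<open>p\<^sup>2\<close> sits in the other, which leaves at most \<open>2\<close>.\<close>
  have small: "b \<le> 2" if "\<not> p dvd b" "a * b = 2 * p ^ 2" for a b :: nat
  proof -
    have "coprime b (p ^ 2)"
      using that(1) assms(1) by (metis coprime_commute coprime_power_right_iff prime_imp_coprime)
    moreover have "b dvd 2 * p ^ 2" using that(2) by (metis dvd_triv_right)
    ultimately have "b dvd 2" by (simp add: coprime_dvd_mult_left_iff)
    then show ?thesis by (simp add: dvd_imp_le)
  qed
  have "p dvd x" "p dvd y"
    using small[of y x] small[of x y] assms(2-4) by (auto simp: mult.commute)
  then obtain a b where ab: "x = p * a" "y = p * b" by (auto elim!: dvdE)
  have "p > 0" using assms(1) by (rule prime_gt_0_nat)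
  then have "a * b = 2" using assms(2) ab by (simp add: power2_eq_square)
  then have "prime (a * b)" by simp
  then have "a = 1 \<or> b = 1" by (metis prime_product)
  then show ?thesis using ab by auto
qed

text \<open>
  The two congruences \<open>p \<equiv> 1\<close> and \<open>1 + p + p\<^sup>2 \<equiv> 0\<close> modulo the prime underlying \<open>u\<close> force
  this prime to be \<open>3\<close>, and \<open>9\<close> never divides \<open>1 + p + p\<^sup>2\<close>.
\<close>

lemma not_sigma_eq_prime_of_dvd:
  fixes p u :: nat
  assumes "prime p" "u dvd 1 + p + p ^ 2" "u > 1"
  shows "sigma u \<noteq> p"
proof
  assume sig: "sigma u = p"
  then obtain r b where rb: "prime r" "b > 0" "u = r ^ b"
    using prime_sigma_imp_prime_power[of u] assms by auto
  obtain c where c: "p = 1 + r * c"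
    using sigma_prime_power_mod[OF rb(1), of b] sig rb(3) by auto
  have expand: "1 + p + p ^ 2 = 3 + r * (3 * c + r * c ^ 2)"
    by (simp add: c power2_eq_square algebra_simps)
  have "r dvd u" using rb by simp
  then have "r dvd 3 + r * (3 * c + r * c ^ 2)"
    using assms(2) expand dvd_trans by metis
  then have "r dvd 3" by (metis dvd_add_left_iff dvd_triv_left)
  then have r3: "r = 3" using rb(1) primes_dvd_imp_eq[of r 3] by simp
  show False
  proof (cases "b = 1")
    case True
    then have "p = 4" using sig rb sigma_prime_power[OF rb(1), of 1] r3 by simp
    moreover have "\<not> prime (4::nat)" using prime_product[of 2 2] by auto
    ultimately show False using assms(1) by simp
  next
    case False
    then have "3 ^ 2 dvd u" using rb r3 le_imp_power_dvd[of 2 b 3] by simp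
    then have "(9::nat) dvd 3 + 9 * (c + c ^ 2)"
      using dvd_trans[OF _ assms(2)] unfolding expand r3
      by (simp add: algebra_simps power2_eq_square)
    then have "(9::nat) dvd 3" by (metis dvd_add_left_iff dvd_triv_left)
    then show False by (simp add: dvd_imp_le)
  qed
qed

theorem mainTheorem1:
  fixes p :: nat
  assumes "prime p" and "odd p"
  shows "\<not> very_perfect (p ^ 2)"
proof
  assume vp: "very_perfect (p ^ 2)"
  define m where "m = 1 + p + p ^ 2"
  have "sigma (p ^ 2) = m"
    unfolding sigma_prime_power[OF assms(1)] m_def by (simp add: eval_nat_numeral)
  then have sig: "sigma m = 2 * p ^ 2" using vp by (simp add: very_perfect_def)
  have "p \<noteq> 2" using assms(2) by auto
  then have p3: "p \<ge> 3" using prime_ge_2_nat[OF assms(1)] by linarith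
  have "odd m" using assms(2) by (simp add: m_def)
  have "m > 1" using p3 by (simp add: m_def)
  then obtain q k v where qk: "prime q" "k > 0" "m = q ^ k * v" "coprime (q ^ k) v" "v > 0"
    by (rule prime_power_cofactor)
  have odds: "odd q" "odd v" using \<open>odd m\<close> qk(2,3) by auto
  then have "q \<noteq> 2" by auto
  then have q3: "q \<ge> 3" using prime_ge_2_nat[OF qk(1)] by linarith
  have qk1: "q ^ k > 1" using one_less_power[OF prime_gt_1_nat] qk(1,2) by blast
  show False
  proof (cases "v = 1")
    case True
    then have "2 * (2 * p ^ 2) \<le> 3 * m"
      using sigma_odd_prime_power_le[OF qk(1) q3, of k] qk(3) sig by simp
    then have le: "p * p \<le> 3 + 3 * p" by (simp add: m_def power2_eq_square)
    have "p < 4"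
    proof (rule ccontr)
      assume "\<not> p < 4"
      then have "4 * p \<le> p * p" by simp
      with le \<open>\<not> p < 4\<close> show False by linarith
    qed
    then have "p = 3" using p3 by simp
    \<comment> \<open>The bound \<open>36 \<le> 39\<close> survives here, so the value \<open>\<sigma>(13) = 14\<close> itself is compared with \<open>18\<close>.\<close>
    moreover have "prime (13::nat)" by simp
    then have "sigma 13 = 14" using sigma_prime_power[of 13 1] by simp
    ultimately show False using sig by (simp add: m_def)
  next
    case False
    then have "v > 1" using qk(5) by simp
    then have gt: "sigma (q ^ k) > 2" "sigma v > 2"
      using sigma_gt[OF qk1] sigma_gt[of v] qk1 by linarith+
    have "sigma (q ^ k) * sigma v = 2 * p ^ 2"
      using sig qk(3,4) by (simp add: sigma_mult_coprime)
    then have "sigma (q ^ k) = p \<or> sigma v = p"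
      using factor_twice_prime_square assms(1) gt by blast
    moreover have "q ^ k dvd 1 + p + p ^ 2" "v dvd 1 + p + p ^ 2"
      using qk(3) unfolding m_def by (metis dvd_triv_left, metis dvd_triv_right)
    ultimately show False
      using not_sigma_eq_prime_of_dvd assms(1) qk1 \<open>v > 1\<close> by blast
  qed
qed

end
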